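(* Let $z(x,y)$ be implicitly defined by $$\zeta(z(x,y))=\phi(x)\psi(y),$$ where $\phi,\psi,\zeta$ are $C^2$-regular functions of one real variable satisfying $$\phi'^2=a_1-2b_1\phi^2+c_1\phi^4,\qquad \psi'^2=a_2-2b_2\psi^2+c_2\psi^4,\qquad \zeta'^2=c_3+2b_3\zeta^2+a_3\zeta^4$$ with real constants $a_i,b_i,c_i$ ($i=1,2,3$). Put $\beta_1=b_2+b_3$, $\beta_2=b_1+b_3$, $\beta_3=b_1+b_2$. Then $z(x,y)$ is a solution of $$(1-z_y^2)z_{xx}+2z_xz_yz_{xy}+(1-z_x^2)z_{yy}=0$$ if and only if the matrix $$A=\begin{pmatrix}a_1&\beta_1&c_1\\ a_2&\beta_2&c_2\\ a_3&\beta_3&c_3\end{pmatrix}$$ is generating.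
   Context: A non-zero real $3\times3$ matrix $A=(a_{ij})$ is called generating if for all permutations $(i,j,k)$ and $(\alpha,\beta,\gamma)$ of $\{1,2,3\}$ one has $a_{i\alpha}a_{i\beta}=a_{j\gamma}a_{k\gamma}$.
   Formalization: φ and ψ are assumed non-constant and ζ'(z)≠0 on the domain; "only if" is stated only for solutions other than planes and surfaces with z_x²≡1 or z_y²≡1, where it can fail, e.g. z=(x+y)/2 from φ=e^{x/2}, ψ=e^{y/2}, ζ=e^z. *)

theory Defs
  imports "HOL-Analysis.Analysis"
begin

definition generating :: "real^3^3 \<Rightarrow> bool" where
  "generating A \<longleftrightarrow> A \<noteq> 0 \<and>
     (\<forall>i j k \<alpha> \<beta> \<gamma>. {i, j, k} = UNIV \<and> {\<alpha>, \<beta>, \<gamma>} = UNIV \<longrightarrow>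
        A $ i $ \<alpha> * A $ i $ \<beta> = A $ j $ \<gamma> * A $ k $ \<gamma>)"

text \<open>The sets below are meant to be open; only then do \<^term>\<open>deriv\<close> and the partial
  derivatives at a point depend on the values inside the set alone.\<close>

definition C2_on :: "real set \<Rightarrow> (real \<Rightarrow> real) \<Rightarrow> bool" where
  "C2_on I f \<longleftrightarrow> f differentiable_on I \<and> deriv f differentiable_on I
     \<and> continuous_on I (deriv (deriv f))"

definition dx :: "(real \<Rightarrow> real \<Rightarrow> real) \<Rightarrow> real \<Rightarrow> real \<Rightarrow> real" where
  "dx z x y = deriv (\<lambda>s. z s y) x"

definition dy :: "(real \<Rightarrow> real \<Rightarrow> real) \<Rightarrow> real \<Rightarrow> real \<Rightarrow> real" where
  "dy z x y = deriv (\<lambda>t. z x t) y"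

definition C1_on_plane :: "(real \<times> real) set \<Rightarrow> (real \<Rightarrow> real \<Rightarrow> real) \<Rightarrow> bool" where
  "C1_on_plane D z \<longleftrightarrow>
     (\<forall>(x, y) \<in> D. (\<lambda>s. z s y) differentiable at x \<and> (\<lambda>t. z x t) differentiable at y)
     \<and> continuous_on D (\<lambda>(x, y). dx z x y) \<and> continuous_on D (\<lambda>(x, y). dy z x y)"

definition C2_on_plane :: "(real \<times> real) set \<Rightarrow> (real \<Rightarrow> real \<Rightarrow> real) \<Rightarrow> bool" where
  "C2_on_plane D z \<longleftrightarrow> C1_on_plane D z \<and> C1_on_plane D (dx z) \<and> C1_on_plane D (dy z)"

definition maximal_surface_solution :: "(real \<times> real) set \<Rightarrow> (real \<Rightarrow> real \<Rightarrow> real) \<Rightarrow> bool" where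
  "maximal_surface_solution D z \<longleftrightarrow> C2_on_plane D z \<and>
     (\<forall>(x, y) \<in> D. (1 - (dy z x y)\<^sup>2) * dx (dx z) x y + 2 * dx z x y * dy z x y * dy (dx z) x y
        + (1 - (dx z x y)\<^sup>2) * dy (dy z) x y = 0)"

text \<open>Planes, and the cylinders \<open>z = \<plusminus>x + g(y)\<close>, \<open>z = \<plusminus>y + g(x)\<close>: these solve the
  equation whatever the function \<open>g\<close> is. For example \<open>\<phi>(x) = x\<close>, \<open>\<psi>(y) = e\<^sup>y\<close>,
  \<open>\<zeta>(z) = e\<^sup>z\<close> gives the solution \<open>z = y + ln x\<close>, and \<open>\<phi>(x) = e\<^sup>x\<^sup>/\<^sup>2\<close>, \<open>\<psi>(y) = e\<^sup>y\<^sup>/\<^sup>2\<close>,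
  \<open>\<zeta>(z) = e\<^sup>z\<close> gives \<open>z = (x + y)/2\<close>; in both cases the matrix of coefficients is not generating.\<close>

definition trivial_solution :: "(real \<times> real) set \<Rightarrow> (real \<Rightarrow> real \<Rightarrow> real) \<Rightarrow> bool" where
  "trivial_solution D z \<longleftrightarrow>
     (\<exists>p q r. \<forall>(x, y) \<in> D. z x y = p * x + q * y + r)
     \<or> (\<forall>(x, y) \<in> D. (dx z x y)\<^sup>2 = 1) \<or> (\<forall>(x, y) \<in> D. (dy z x y)\<^sup>2 = 1)"

text \<open>\<open>z\<close> is a continuous solution on \<open>D\<close> of \<open>\<zeta>(z) = \<phi>(x) \<psi>(y)\<close> at which the implicit function
  theorem applies; \<open>C\<^sup>2\<close>-regularity of \<open>z\<close> is a consequence.\<close>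

definition implicitly_defined ::
  "(real \<times> real) set \<Rightarrow> (real \<Rightarrow> real) \<Rightarrow> (real \<Rightarrow> real) \<Rightarrow> (real \<Rightarrow> real) \<Rightarrow> (real \<Rightarrow> real \<Rightarrow> real) \<Rightarrow> bool"
  where
  "implicitly_defined D \<phi> \<psi> \<zeta> z \<longleftrightarrow> continuous_on D (\<lambda>(x, y). z x y) \<and>
     (\<forall>(x, y) \<in> D. \<zeta> (z x y) = \<phi> x * \<psi> y \<and> deriv \<zeta> (z x y) \<noteq> 0)"

end

theory Submission
  imports Defs
begin

text \<open>Differentiating \<open>\<zeta>(z) = \<phi>(x) \<psi>(y)\<close> twice and eliminating the derivatives of \<open>\<phi>\<close>, \<open>\<psi>\<close>, \<open>\<zeta>\<close> by
  means of their differential equations turns the surface equation into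
  \<open>\<phi> \<psi> G(\<phi>\<^sup>2, \<psi>\<^sup>2) = 0\<close> with a polynomial \<open>G\<close> whose six coefficients are the defects of six of the
  generating relations. As \<open>\<phi>\<close> and \<open>\<psi>\<close> are not locally constant, \<open>G\<close> vanishes identically. The other
  three relations follow algebraically unless two rows of the matrix have \<open>a = c = 0\<close>; then either
  \<open>z\<^sub>x\<^sup>2 = 1\<close>, or \<open>z\<^sub>y\<^sup>2 = 1\<close>, or all three functions are exponentials and \<open>z\<close> is affine.\<close>

section \<open>Real solutions of f'^2 = P(f) on an interval\<close>

lemma C2_on_has_derivs:
  assumes "open I" "C2_on I f" "x \<in> I"
  shows "(f has_real_derivative deriv f x) (at x)"
    and "(deriv f has_real_derivative deriv (deriv f) x) (at x)"
  using assms
  by (auto simp: C2_on_def differentiable_on_eq_differentiable_at DERIV_deriv_iff_real_differentiable)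

lemma C2_on_continuous_on:
  assumes "C2_on I f"
  shows "continuous_on I f" "continuous_on I (deriv f)" "continuous_on I (deriv (deriv f))"
  using assms by (auto simp: C2_on_def differentiable_imp_continuous_on)

lemma DERIV_zero_connected_constant_on:
  fixes f :: "real \<Rightarrow> real"
  assumes "open I" "connected I" "\<And>x. x \<in> I \<Longrightarrow> (f has_real_derivative 0) (at x)"
  shows "f constant_on I"
proof -
  have "(f has_derivative (\<lambda>_. 0)) (at x)" if "x \<in> I" for x
    using assms(3)[OF that] by (simp add: has_field_derivative_def mult_zero_left[abs_def])
  from has_derivative_zero_unique_connected[OF assms(1,2) this]
  show ?thesis
    unfolding constant_on_def by blast
qed

lemma zero_deriv_imp_constant_on:
  assumes "open I" "connected I" "C2_on I f" "\<And>x. x \<in> I \<Longrightarrow> deriv f x = 0"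
  shows "f constant_on I"
  using DERIV_zero_connected_constant_on[OF assms(1,2)] C2_on_has_derivs(1)[OF assms(1,3)] assms(4)
  by metis

text \<open>Differentiating the equation gives 2 f' f'' = P'(f) f', and f' cancels at
  \<open>x\<close>.\<close>

lemma ode_second_deriv_of_deriv_nonzero:
  fixes P :: "real poly"
  assumes "open I" "C2_on I f" and ode: "\<And>x. x \<in> I \<Longrightarrow> (deriv f x)\<^sup>2 = poly P (f x)"
    and "x \<in> I" "deriv f x \<noteq> 0"
  shows "deriv (deriv f) x = poly (pderiv P) (f x) / 2"
proof -
  note d = C2_on_has_derivs[OF assms(1,2,4)]
  have 1: "((\<lambda>t. (deriv f t)\<^sup>2) has_real_derivative 2 * deriv f x * deriv (deriv f) x) (at x)"
    by (rule derivative_eq_intros d refl | simp)+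
  have "((\<lambda>t. poly P (f t)) has_real_derivative poly (pderiv P) (f x) * deriv f x) (at x)"
    using DERIV_chain2[OF poly_DERIV d(1)] .
  then have 2: "((\<lambda>t. (deriv f t)\<^sup>2) has_real_derivative poly (pderiv P) (f x) * deriv f x) (at x)"
    by (rule has_field_derivative_transform_within_open[OF _ assms(1,4)]) (simp add: ode)
  show ?thesis
    using DERIV_unique[OF 1 2] assms(5) by (auto simp: field_simps)
qed

text \<open>Where \<open>f' = 0\<close> the equation \<open>f'' = P'(f)/2\<close> cannot be obtained by differentiating. But there
  \<open>f\<close> is a root of \<open>P\<close>, and at inner points of that set \<open>f'' = 0\<close>; hence the continuous defect
  \<open>f'' - P'(f)/2\<close> takes finitely many values and is constant.\<close>

lemma ode_second_deriv:
  fixes P :: "real poly"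
  assumes I: "open I" "connected I" and C2: "C2_on I f"
    and ode: "\<And>x. x \<in> I \<Longrightarrow> (deriv f x)\<^sup>2 = poly P (f x)"
    and nc: "\<not> f constant_on I" and x: "x \<in> I"
  shows "deriv (deriv f) x = poly (pderiv P) (f x) / 2"
proof -
  define g where "g t = deriv (deriv f) t - poly (pderiv P) (f t) / 2" for t
  have g0: "g t = 0" if "t \<in> I" "deriv f t \<noteq> 0" for t
    using ode_second_deriv_of_deriv_nonzero[OF I(1) C2 ode that] by (simp add: g_def)
  \<comment> \<open>The point \<open>x0\<close> serves twice: it forces \<open>P\<close> to be
    non-zero, hence to have finitely many roots, and it later fixes the constant value of
    \<open>g\<close> as 0.\<close>
  obtain x0 where x0: "x0 \<in> I" "deriv f x0 \<noteq> 0"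
    using zero_deriv_imp_constant_on[OF I C2] nc by blast
  have P0: "P \<noteq> 0"
    using ode[OF x0(1)] x0(2) by auto
  have cont: "continuous_on I g"
    unfolding g_def by (intro continuous_intros C2_on_continuous_on[OF C2]) simp
  have "g t \<in> insert 0 ((\<lambda>r. - poly (pderiv P) r / 2) ` {r. poly P r = 0})" if t: "t \<in> I" for t
  proof (cases "g t = 0")
    case False
    let ?U = "I \<inter> g -` (- {0})"
    have U: "open ?U" "t \<in> ?U"
      using continuous_open_preimage[OF cont I(1), of "- {0}"] False t by auto
    have f0: "deriv f s = 0" if "s \<in> ?U" for s
      using g0 that by auto
    have "(deriv f has_real_derivative 0) (at t)"
      by (rule has_field_derivative_transform_within_open[OF DERIV_const U]) (simp add: f0)
    then have "deriv (deriv f) t = 0"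
      by (rule DERIV_imp_deriv)
    moreover have "poly P (f t) = 0"
      using ode[OF t] f0[OF U(2)] by simp
    ultimately show ?thesis
      by (auto simp: g_def)
  qed simp
  then have "finite (g ` I)"
    by (intro finite_subset[OF _ finite.insertI[OF finite_imageI[OF poly_roots_finite[OF P0]]]]) blast
  then have "g constant_on I"
    using continuous_finite_range_constant[OF I(2) cont] by simp
  then have "g x = g x0"
    using x x0(1) by (auto simp: constant_on_def)
  then show ?thesis
    using g0[OF x0] by (simp add: g_def)
qed

text \<open>A double root makes f' at most a multiple of |f - r| near any point where f = r. On a
  short enough interval the mean value inequality then bounds the maximum of |f - r| by half of
  itself, so it is 0. The level set of \<open>r\<close> is therefore open and closed in
  \<open>I\<close>.\<close>

lemma ode_uniqueness_at_double_root:
  fixes P :: "real poly"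
  assumes I: "open I" "connected I" and C2: "C2_on I f"
    and ode: "\<And>x. x \<in> I \<Longrightarrow> (deriv f x)\<^sup>2 = poly P (f x)"
    and dr: "[:-r, 1:]\<^sup>2 dvd P" and x0: "x0 \<in> I" "f x0 = r"
  shows "f constant_on I"
proof -
  obtain S where S: "P = [:-r, 1:]\<^sup>2 * S"
    using dr by (rule dvdE)
  note cf = C2_on_continuous_on[OF C2]
  let ?E = "I \<inter> f -` {r}"
  have "\<exists>e>0. \<forall>y\<in>I. dist y x < e \<longrightarrow> y \<in> ?E" if xE: "x \<in> ?E" for x
  proof -
    obtain d where d: "d > 0" "cball x d \<subseteq> I"
      using xE open_contains_cball[THEN iffD1, OF I(1)] by blast
    have "continuous_on (cball x d) (\<lambda>t. poly S (f t))"
      by (intro continuous_intros continuous_on_subset[OF cf(1) d(2)])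
    then have "bounded ((\<lambda>t. poly S (f t)) ` cball x d)"
      by (intro compact_imp_bounded compact_continuous_image) auto
    then obtain B where B: "B > 0" "\<And>t. t \<in> cball x d \<Longrightarrow> \<bar>poly S (f t)\<bar> \<le> B"
      by (fastforce simp: bounded_pos)
    \<comment> \<open>Adding 1 ensures 1 \<le> \<open>C\<close>, so the bound on
      \<open>poly S (f t)\<close> is also at most \<open>C\<close>^2 and square roots can be
      taken.\<close>
    define C where "C = B + 1"
    have C: "C > 0" "\<And>t. t \<in> cball x d \<Longrightarrow> \<bar>deriv f t\<bar> \<le> C * \<bar>f t - r\<bar>"
    proof -
      fix t assume t: "t \<in> cball x d"
      have "(deriv f t)\<^sup>2 = (f t - r)\<^sup>2 * poly S (f t)"
        using ode[of t] t d(2) by (auto simp: S power2_eq_square algebra_simps)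
      also have "\<dots> \<le> (f t - r)\<^sup>2 * C\<^sup>2"
      proof (intro mult_left_mono)
        have "poly S (f t) \<le> C" "1 \<le> C" using B(1) B(2)[OF t] by (auto simp: C_def)
        then show "poly S (f t) \<le> C\<^sup>2"
          using self_le_power[of C 2] by simp
      qed simp
      finally have "(deriv f t)\<^sup>2 \<le> (C * \<bar>f t - r\<bar>)\<^sup>2"
        by (simp add: power_mult_distrib mult.commute)
      then show "\<bar>deriv f t\<bar> \<le> C * \<bar>f t - r\<bar>"
        using B(1) by (simp add: C_def abs_le_square_iff[symmetric] abs_mult)
    qed (use B(1) in \<open>simp add: C_def\<close>)
    \<comment> \<open>The radius is chosen so that \<open>C * e\<close> is at most 1/2, the
      contraction factor used below.\<close>
    define e where "e = min d (1 / (2 * C))"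
    have e: "e > 0" "cball x e \<subseteq> cball x d"
      using d(1) C(1) by (auto simp: e_def)
    have "C * e \<le> C * (1 / (2 * C))"
      using C(1) by (intro mult_left_mono) (auto simp: e_def)
    then have Ce: "C * e \<le> 1 / 2"
      using C(1) by simp
    have "continuous_on (cball x e) (\<lambda>t. \<bar>f t - r\<bar>)"
      using e(2) d(2) by (intro continuous_intros continuous_on_subset[OF cf(1)]) auto
    then obtain m where m: "m \<in> cball x e" "\<And>t. t \<in> cball x e \<Longrightarrow> \<bar>f t - r\<bar> \<le> \<bar>f m - r\<bar>"
      using continuous_attains_sup[OF compact_cball, of x e] e(1) by fastforce
    have "norm (f m - f x) \<le> C * \<bar>f m - r\<bar> * norm (m - x)"
    proof (rule field_differentiable_bound[of "cball x e" f "deriv f"])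
      fix t assume t: "t \<in> cball x e"
      show "(f has_real_derivative deriv f t) (at t within cball x e)"
        using t e(2) d(2) C2_on_has_derivs(1)[OF I(1) C2]
        by (meson has_field_derivative_at_within subsetD)
      show "norm (deriv f t) \<le> C * \<bar>f m - r\<bar>"
        using C(2)[of t] m(2)[OF t] t e(2) C(1)
        by (smt (verit, best) mult_left_mono real_norm_def subsetD)
    qed (use m e in auto)
    also have "\<dots> \<le> C * \<bar>f m - r\<bar> * e"
      using m(1) C(1) by (intro mult_left_mono) (auto simp: dist_real_def)
    also have "\<dots> \<le> \<bar>f m - r\<bar> / 2"
      using mult_right_mono[OF Ce, of "\<bar>f m - r\<bar>"] by (simp add: mult_ac)
    finally have "f m = r"
      using xE by simp
    then have "f t = r" if "t \<in> cball x e" for t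
      using m(2)[OF that] by simp
    then show ?thesis
      using e(1) by (intro exI[of _ e]) (auto simp: dist_commute)
  qed
  then have "openin (top_of_set I) ?E"
    by (auto simp: openin_euclidean_subtopology_iff)
  moreover have "closedin (top_of_set I) ?E"
    using continuous_closedin_preimage[OF cf(1)] by simp
  ultimately have "?E = I"
    using I(2) x0 by (auto simp: connected_clopen)
  then show ?thesis
    by (auto simp: constant_on_def)
qed

text \<open>If f = r on an open set, then f' = f'' = 0 there. The equation gives P(r) = 0 and
  \<open>ode_second_deriv\<close>, which holds even where f' = 0, gives P'(r) = 0. So
  \<open>r\<close> is a double root and f would be constant on all of \<open>I\<close>.\<close>

lemma ode_not_locally_constant:
  fixes P :: "real poly"
  assumes I: "open I" "connected I" and C2: "C2_on I f"
    and ode: "\<And>x. x \<in> I \<Longrightarrow> (deriv f x)\<^sup>2 = poly P (f x)"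
    and nc: "\<not> f constant_on I" and T: "open T" "T \<subseteq> I" "T \<noteq> {}"
  shows "\<not> f constant_on T"
proof
  assume "f constant_on T"
  then obtain r where r: "\<And>t. t \<in> T \<Longrightarrow> f t = r"
    by (auto simp: constant_on_def)
  have d0: "deriv f t = 0" if "t \<in> T" for t
    by (intro DERIV_imp_deriv has_field_derivative_transform_within_open[OF DERIV_const T(1) that])
       (simp add: r)
  obtain t where t: "t \<in> T" "t \<in> I"
    using T by blast
  have "deriv (deriv f) t = 0"
    by (intro DERIV_imp_deriv has_field_derivative_transform_within_open[OF DERIV_const T(1) t(1)])
       (simp add: d0)
  then have P': "poly (pderiv P) r = 0"
    using ode_second_deriv[OF I C2 ode nc t(2)] r[OF t(1)] by simp
  have "poly P r = 0"
    using ode[OF t(2)] d0[OF t(1)] r[OF t(1)] by simp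
  then obtain S where S: "P = [:-r, 1:] * S"
    by (auto simp: poly_eq_0_iff_dvd)
  have "poly S r = 0"
    using P' unfolding S pderiv_mult by (simp add: pderiv_pCons)
  then have "[:-r, 1:]\<^sup>2 dvd P"
    unfolding S power2_eq_square poly_eq_0_iff_dvd by (rule mult_dvd_mono[OF dvd_refl])
  then show False
    using ode_uniqueness_at_double_root[OF I C2 ode _ t(2) r[OF t(1)]] nc by blast
qed

text \<open>Supplies enough values for comparing coefficients in even powers of f. A connected
  non-constant image is infinite, and squaring is at most two-to-one. The value 0 is removed so that
  factors f can be cancelled.\<close>

lemma ode_infinite_squares:
  fixes P :: "real poly"
  assumes I: "open I" "connected I" and C2: "C2_on I f"
    and ode: "\<And>x. x \<in> I \<Longrightarrow> (deriv f x)\<^sup>2 = poly P (f x)"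
    and nc: "\<not> f constant_on I" and T: "open T" "connected T" "T \<subseteq> I" "T \<noteq> {}"
  shows "infinite ((\<lambda>x. (f x)\<^sup>2) ` T - {0})"
proof -
  have "connected (f ` T)"
    using connected_continuous_image[OF continuous_on_subset[OF C2_on_continuous_on(1)[OF C2] T(3)] T(2)] .
  moreover have "f ` T \<noteq> {}" "\<nexists>r. f ` T = {r}"
    using ode_not_locally_constant[OF I C2 ode nc T(1,3,4)] T(4) by (auto simp: constant_on_def)
  ultimately have "infinite (f ` T)"
    by (simp add: connected_finite_iff_sing)
  moreover have "f ` T \<subseteq> (\<lambda>s. sqrt s) ` ((\<lambda>x. (f x)\<^sup>2) ` T) \<union> (\<lambda>s. - sqrt s) ` ((\<lambda>x. (f x)\<^sup>2) ` T)"
    by (force simp: image_image abs_if)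
  ultimately have "infinite ((\<lambda>x. (f x)\<^sup>2) ` T)"
    by (meson finite_UnI finite_imageI finite_subset)
  then show ?thesis
    by simp
qed

text \<open>The first-order equation only gives f' = \<plusminus>k f with a sign that could depend
  on the point. The second-order equation f'' = k^2 f makes (f' + k f) exp(-k x) and (f' - k f)
  exp(k x) constant; their product f'^2 - k^2 f^2 is 0, so one of them vanishes on all of
  \<open>I\<close> and the sign is global. The logarithmic form of the conclusion turns products
  into sums.\<close>

lemma exponential_of_ode:
  fixes f :: "real \<Rightarrow> real"
  assumes I: "open I" "connected I" and C2: "C2_on I f"
    and ode: "\<And>x. x \<in> I \<Longrightarrow> (deriv f x)\<^sup>2 = \<kappa> * (f x)\<^sup>2"
    and nc: "\<not> f constant_on I"
  obtains m n where "m \<noteq> 0" "\<And>x. x \<in> I \<Longrightarrow> f x \<noteq> 0 \<and> ln \<bar>f x\<bar> = m * x + n"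
proof -
  obtain x0 where x0: "x0 \<in> I" "deriv f x0 \<noteq> 0"
    using zero_deriv_imp_constant_on[OF I C2] nc by blast
  then have "0 < \<kappa> * (f x0)\<^sup>2"
    using ode[OF x0(1)] by (metis zero_less_power2)
  then have "\<kappa> > 0"
    by (simp add: zero_less_mult_iff)
  define k where "k = sqrt \<kappa>"
  have k: "k \<noteq> 0" "\<kappa> = k\<^sup>2"
    using \<open>\<kappa> > 0\<close> by (auto simp: k_def)
  have "(deriv f x)\<^sup>2 = poly [:0, 0, \<kappa>:] (f x)" if "x \<in> I" for x
    using ode[OF that] by (simp add: power2_eq_square)
  from ode_second_deriv[OF I C2 this nc]
  have f2: "deriv (deriv f) x = k\<^sup>2 * f x" if "x \<in> I" for x
    using that k(2) by (simp add: pderiv_pCons)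
  note d = C2_on_has_derivs[OF I(1) C2]
  have const: "(\<lambda>x. (deriv f x + l * f x) * exp (- l * x)) constant_on I" if l: "l\<^sup>2 = k\<^sup>2" for l
  proof (rule DERIV_zero_connected_constant_on[OF I])
    fix x assume x: "x \<in> I"
    have "l * (l * f x) = k * (k * f x)"
      using l by (simp add: power2_eq_square flip: mult.assoc)
    then show "((\<lambda>x. (deriv f x + l * f x) * exp (- l * x)) has_real_derivative 0) (at x)"
      by (auto intro!: derivative_eq_intros d[OF x] simp: f2[OF x] algebra_simps power2_eq_square)
  qed
  obtain c1 where c1: "\<And>x. x \<in> I \<Longrightarrow> (deriv f x + k * f x) * exp (- k * x) = c1"
    using const[of k] by (auto simp: constant_on_def)
  obtain c2 where c2: "\<And>x. x \<in> I \<Longrightarrow> (deriv f x - k * f x) * exp (k * x) = c2"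
    using const[of "-k"] by (auto simp: constant_on_def)
  have "c1 * c2 = ((deriv f x0)\<^sup>2 - k\<^sup>2 * (f x0)\<^sup>2) * (exp (- k * x0) * exp (k * x0))"
    unfolding c1[OF x0(1), symmetric] c2[OF x0(1), symmetric]
    by (simp add: power2_eq_square algebra_simps)
  then have "c1 * c2 = 0"
    using ode[OF x0(1)] k(2) by simp
  then have "\<exists>m. m \<noteq> 0 \<and> (\<forall>x\<in>I. deriv f x = m * f x)"
  proof (cases "c1 = 0")
    case True
    then show ?thesis
      using c1 k(1) by (intro exI[of _ "-k"]) (auto simp: add_eq_0_iff)
  next
    case False
    then show ?thesis
      using c2 k(1) \<open>c1 * c2 = 0\<close> by (intro exI[of _ k]) auto
  qed
  then obtain m where m: "m \<noteq> 0" "\<And>x. x \<in> I \<Longrightarrow> deriv f x = m * f x"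
    by auto
  have "(\<lambda>x. f x * exp (- m * x)) constant_on I"
  proof (rule DERIV_zero_connected_constant_on[OF I])
    fix x assume x: "x \<in> I"
    show "((\<lambda>x. f x * exp (- m * x)) has_real_derivative 0) (at x)"
      by (auto intro!: derivative_eq_intros d[OF x] simp: m(2)[OF x])
  qed
  then obtain c where c: "\<And>x. x \<in> I \<Longrightarrow> f x * exp (- m * x) = c"
    by (auto simp: constant_on_def)
  have f: "f x = c * exp (m * x)" if "x \<in> I" for x
    using c[OF that] by (simp add: exp_minus field_simps)
  have "c \<noteq> 0"
    using f nc by (auto simp: constant_on_def)
  then show thesis
    using m(1) f by (intro that[of m "ln \<bar>c\<bar>"]) (auto simp: abs_mult ln_mult)
qed

section \<open>Regularity and partial derivatives of the implicitly defined surface\<close>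

text \<open>By Caratheodory's factorisation f(t) - f(g(x)) = S(t) (t - g(x)) with S continuous at
  g(x), the difference quotient of g is that of f o g divided by S(g(s)). This divisor tends to
  \<open>f'\<close> and so is non-zero near \<open>x\<close>; mere continuity of g suffices.\<close>

lemma DERIV_implicit:
  fixes f g :: "real \<Rightarrow> real"
  assumes "isCont g x" "(f has_real_derivative f') (at (g x))" "f' \<noteq> 0"
    and "((\<lambda>s. f (g s)) has_real_derivative h') (at x)"
  shows "(g has_real_derivative h' / f') (at x)"
proof -
  obtain S where S: "\<And>t. f t - f (g x) = S t * (t - g x)" "isCont S (g x)" "S (g x) = f'"
    using assms(2) by (auto simp: CARAT_DERIV)
  have lim: "((\<lambda>s. S (g s)) \<longlongrightarrow> f') (at x)"
    using isCont_o2[OF assms(1) S(2)] S(3) by (simp add: isCont_def)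
  have "((\<lambda>s. (f (g s) - f (g x)) / (s - x) / S (g s)) \<longlongrightarrow> h' / f') (at x)"
    using assms(3,4) lim by (intro tendsto_divide) (auto simp: has_field_derivative_iff)
  moreover have "\<forall>\<^sub>F s in at x. (f (g s) - f (g x)) / (s - x) / S (g s) = (g s - g x) / (s - x)"
    using tendsto_imp_eventually_ne[OF lim assms(3)] by eventually_elim (simp add: S(1))
  ultimately show ?thesis
    unfolding has_field_derivative_iff by (rule Lim_transform_eventually)
qed

lemma open_sections:
  assumes "open D"
  shows "open ((\<lambda>s. (s, y)) -` D)" "open ((\<lambda>t. (x, t)) -` D)"
  by (intro open_vimage assms continuous_intros)+

locale implicit_surface =
  fixes \<phi> \<psi> \<zeta> :: "real \<Rightarrow> real" and z :: "real \<Rightarrow> real \<Rightarrow> real"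
    and I J K :: "real set" and D :: "(real \<times> real) set"
  assumes open_I: "open I" and open_J: "open J" and open_K: "open K"
    and C2_\<phi>: "C2_on I \<phi>" and C2_\<psi>: "C2_on J \<psi>" and C2_\<zeta>: "C2_on K \<zeta>"
    and open_D: "open D" and D_subset: "D \<subseteq> I \<times> J"
    and z_in_K: "\<And>x y. (x, y) \<in> D \<Longrightarrow> z x y \<in> K"
    and implicit: "implicitly_defined D \<phi> \<psi> \<zeta> z"
begin

lemma in_D:
  assumes "(x, y) \<in> D"
  shows "x \<in> I" "y \<in> J" "z x y \<in> K" "\<zeta> (z x y) = \<phi> x * \<psi> y" "deriv \<zeta> (z x y) \<noteq> 0"
  using assms D_subset z_in_K implicit by (auto simp: implicitly_defined_def)

lemma continuous_on_z: "continuous_on D (\<lambda>p. z (fst p) (snd p))"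
  using implicit by (simp add: implicitly_defined_def case_prod_unfold)

lemma isCont_z:
  assumes "(x, y) \<in> D"
  shows "isCont (\<lambda>s. z s y) x" "isCont (\<lambda>t. z x t) y"
proof -
  have "continuous_on ((\<lambda>s. (s, y)) -` D) (\<lambda>s. z s y)"
    using continuous_on_compose2[OF continuous_on_z, of "(\<lambda>s. (s, y)) -` D" "\<lambda>s. (s, y)"]
    by (auto simp: continuous_on_Pair)
  then show "isCont (\<lambda>s. z s y) x"
    using assms open_sections(1)[OF open_D, of y] by (auto simp: continuous_on_eq_continuous_at)
  have "continuous_on ((\<lambda>t. (x, t)) -` D) (\<lambda>t. z x t)"
    using continuous_on_compose2[OF continuous_on_z, of "(\<lambda>t. (x, t)) -` D" "\<lambda>t. (x, t)"]
    by (auto simp: continuous_on_Pair)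
  then show "isCont (\<lambda>t. z x t) y"
    using assms open_sections(2)[OF open_D, of x] by (auto simp: continuous_on_eq_continuous_at)
qed

lemma z_has_partial_derivs:
  assumes xy: "(x, y) \<in> D"
  shows "((\<lambda>s. z s y) has_real_derivative deriv \<phi> x * \<psi> y / deriv \<zeta> (z x y)) (at x)"
    and "((\<lambda>t. z x t) has_real_derivative \<phi> x * deriv \<psi> y / deriv \<zeta> (z x y)) (at y)"
proof -
  note z = C2_on_has_derivs(1)[OF open_K C2_\<zeta> in_D(3)[OF xy]]
  have "((\<lambda>s. \<phi> s * \<psi> y) has_real_derivative deriv \<phi> x * \<psi> y) (at x)"
    by (rule DERIV_cmult_right[OF C2_on_has_derivs(1)[OF open_I C2_\<phi> in_D(1)[OF xy]]])
  then have "((\<lambda>s. \<zeta> (z s y)) has_real_derivative deriv \<phi> x * \<psi> y) (at x)"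
    by (rule has_field_derivative_transform_within_open[OF _ open_sections(1)[OF open_D, of y]])
       (use xy in_D(4) in auto)
  then show "((\<lambda>s. z s y) has_real_derivative deriv \<phi> x * \<psi> y / deriv \<zeta> (z x y)) (at x)"
    by (rule DERIV_implicit[OF isCont_z(1)[OF xy] z in_D(5)[OF xy]])
  have "((\<lambda>t. \<phi> x * \<psi> t) has_real_derivative \<phi> x * deriv \<psi> y) (at y)"
    by (rule DERIV_cmult[OF C2_on_has_derivs(1)[OF open_J C2_\<psi> in_D(2)[OF xy]]])
  then have "((\<lambda>t. \<zeta> (z x t)) has_real_derivative \<phi> x * deriv \<psi> y) (at y)"
    by (rule has_field_derivative_transform_within_open[OF _ open_sections(2)[OF open_D, of x]])
       (use xy in_D(4) in auto)
  then show "((\<lambda>t. z x t) has_real_derivative \<phi> x * deriv \<psi> y / deriv \<zeta> (z x y)) (at y)"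
    by (rule DERIV_implicit[OF isCont_z(2)[OF xy] z in_D(5)[OF xy]])
qed

lemma partials_z:
  assumes "(x, y) \<in> D"
  shows "dx z x y = deriv \<phi> x * \<psi> y / deriv \<zeta> (z x y)"
    and "dy z x y = \<phi> x * deriv \<psi> y / deriv \<zeta> (z x y)"
  using z_has_partial_derivs[OF assms] by (auto simp: dx_def dy_def DERIV_imp_deriv)

text \<open>Both first partial derivatives of \<open>z\<close> have the shape of \<open>w\<close>,
  so one quotient rule yields all second ones. Writing the result with \<open>w\<close> itself
  leaves only a single power of \<open>deriv \<zeta>\<close> in the denominator.\<close>

lemma quotient_has_partial_derivs:
  assumes xy: "(x, y) \<in> D" and w: "\<And>x y. (x, y) \<in> D \<Longrightarrow> w x y = f x * g y / deriv \<zeta> (z x y)"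
    and f: "(f has_real_derivative f') (at x)" and g: "(g has_real_derivative g') (at y)"
  shows "((\<lambda>s. w s y) has_real_derivative
      (f' * g y - deriv (deriv \<zeta>) (z x y) * dx z x y * w x y) / deriv \<zeta> (z x y)) (at x)"
    and "((\<lambda>t. w x t) has_real_derivative
      (f x * g' - deriv (deriv \<zeta>) (z x y) * dy z x y * w x y) / deriv \<zeta> (z x y)) (at y)"
proof -
  note z2 = C2_on_has_derivs(2)[OF open_K C2_\<zeta> in_D(3)[OF xy]]
  note n0 = in_D(5)[OF xy]
  have "((\<lambda>s. deriv \<zeta> (z s y)) has_real_derivative deriv (deriv \<zeta>) (z x y) * dx z x y) (at x)"
    using DERIV_chain2[OF z2 z_has_partial_derivs(1)[OF xy]] by (simp add: partials_z(1)[OF xy])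
  from DERIV_divide[OF DERIV_cmult_right[OF f] this n0, of "g y"]
  have "((\<lambda>s. f s * g y / deriv \<zeta> (z s y)) has_real_derivative
      (f' * g y - deriv (deriv \<zeta>) (z x y) * dx z x y * w x y) / deriv \<zeta> (z x y)) (at x)"
    using n0 by (simp add: w[OF xy] diff_divide_distrib mult_ac)
  then show "((\<lambda>s. w s y) has_real_derivative
      (f' * g y - deriv (deriv \<zeta>) (z x y) * dx z x y * w x y) / deriv \<zeta> (z x y)) (at x)"
    by (rule has_field_derivative_transform_within_open[OF _ open_sections(1)[OF open_D, of y]])
       (use xy w in auto)
  have "((\<lambda>t. deriv \<zeta> (z x t)) has_real_derivative deriv (deriv \<zeta>) (z x y) * dy z x y) (at y)"
    using DERIV_chain2[OF z2 z_has_partial_derivs(2)[OF xy]] by (simp add: partials_z(2)[OF xy])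
  from DERIV_divide[OF DERIV_cmult[OF g] this n0, of "f x"]
  have "((\<lambda>t. f x * g t / deriv \<zeta> (z x t)) has_real_derivative
      (f x * g' - deriv (deriv \<zeta>) (z x y) * dy z x y * w x y) / deriv \<zeta> (z x y)) (at y)"
    using n0 by (simp add: w[OF xy] diff_divide_distrib mult_ac)
  then show "((\<lambda>t. w x t) has_real_derivative
      (f x * g' - deriv (deriv \<zeta>) (z x y) * dy z x y * w x y) / deriv \<zeta> (z x y)) (at y)"
    by (rule has_field_derivative_transform_within_open[OF _ open_sections(2)[OF open_D, of x]])
       (use xy w in auto)
qed

lemma continuous_on_fst_snd_z:
  shows "continuous_on I h \<Longrightarrow> continuous_on D (\<lambda>p. h (fst p))"
    and "continuous_on J h \<Longrightarrow> continuous_on D (\<lambda>p. h (snd p))"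
    and "continuous_on K h \<Longrightarrow> continuous_on D (\<lambda>p. h (z (fst p) (snd p)))"
proof -
  show "continuous_on D (\<lambda>p. h (fst p))" if "continuous_on I h"
    by (rule continuous_on_compose2[OF that continuous_on_fst[OF continuous_on_id]])
       (use D_subset in auto)
  show "continuous_on D (\<lambda>p. h (snd p))" if "continuous_on J h"
    by (rule continuous_on_compose2[OF that continuous_on_snd[OF continuous_on_id]])
       (use D_subset in auto)
  show "continuous_on D (\<lambda>p. h (z (fst p) (snd p)))" if "continuous_on K h"
    by (rule continuous_on_compose2[OF that continuous_on_z]) (use z_in_K in auto)
qed

lemma continuous_on_quotient:
  assumes "continuous_on I f" "continuous_on J g"
    and w: "\<And>x y. (x, y) \<in> D \<Longrightarrow> w x y = f x * g y / deriv \<zeta> (z x y)"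
  shows "continuous_on D (\<lambda>p. w (fst p) (snd p))"
proof -
  have "continuous_on D (\<lambda>p. f (fst p) * g (snd p) / deriv \<zeta> (z (fst p) (snd p)))"
    using in_D(5)
    by (intro continuous_intros continuous_on_fst_snd_z assms C2_on_continuous_on[OF C2_\<zeta>]) auto
  then show ?thesis
    by (rule continuous_on_eq) (auto simp: w)
qed

lemma continuous_on_partials_z:
  "continuous_on D (\<lambda>p. dx z (fst p) (snd p))" "continuous_on D (\<lambda>p. dy z (fst p) (snd p))"
  using continuous_on_quotient[OF _ _ partials_z(1)] continuous_on_quotient[OF _ _ partials_z(2)]
  by (simp_all add: C2_on_continuous_on[OF C2_\<phi>] C2_on_continuous_on[OF C2_\<psi>])

lemma C1_on_plane_quotient:
  assumes w: "\<And>x y. (x, y) \<in> D \<Longrightarrow> w x y = f x * g y / deriv \<zeta> (z x y)"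
    and f: "\<And>x. x \<in> I \<Longrightarrow> (f has_real_derivative f' x) (at x)" "continuous_on I f'"
    and g: "\<And>y. y \<in> J \<Longrightarrow> (g has_real_derivative g' y) (at y)" "continuous_on J g'"
  shows "C1_on_plane D w"
proof -
  have cf: "continuous_on I f" "continuous_on J g"
    using f(1) g(1) by (auto intro!: continuous_at_imp_continuous_on DERIV_isCont)
  have D: "((\<lambda>s. w s y) has_real_derivative
        (f' x * g y - deriv (deriv \<zeta>) (z x y) * dx z x y * w x y) / deriv \<zeta> (z x y)) (at x)"
      "((\<lambda>t. w x t) has_real_derivative
        (f x * g' y - deriv (deriv \<zeta>) (z x y) * dy z x y * w x y) / deriv \<zeta> (z x y)) (at y)"
    if "(x, y) \<in> D" for x y
    using quotient_has_partial_derivs[OF that w f(1) g(1)] in_D(1,2)[OF that] by auto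
  note cont = continuous_on_fst_snd_z cf f(2) g(2) continuous_on_quotient[OF cf w]
    C2_on_continuous_on[OF C2_\<zeta>] continuous_on_partials_z
  have "continuous_on D (\<lambda>p. (f' (fst p) * g (snd p)
      - deriv (deriv \<zeta>) (z (fst p) (snd p)) * dx z (fst p) (snd p) * w (fst p) (snd p))
      / deriv \<zeta> (z (fst p) (snd p)))"
    using in_D(5) by (intro continuous_intros cont) auto
  then have "continuous_on D (\<lambda>p. dx w (fst p) (snd p))"
    by (rule continuous_on_eq) (auto simp: dx_def[of w] DERIV_imp_deriv[OF D(1)])
  moreover have "continuous_on D (\<lambda>p. (f (fst p) * g' (snd p)
      - deriv (deriv \<zeta>) (z (fst p) (snd p)) * dy z (fst p) (snd p) * w (fst p) (snd p))
      / deriv \<zeta> (z (fst p) (snd p)))"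
    using in_D(5) by (intro continuous_intros cont) auto
  then have "continuous_on D (\<lambda>p. dy w (fst p) (snd p))"
    by (rule continuous_on_eq) (auto simp: dy_def[of w] DERIV_imp_deriv[OF D(2)])
  ultimately show ?thesis
    using D[THEN has_field_derivative_imp_has_derivative, THEN Derivative.differentiableI] by (auto simp: C1_on_plane_def case_prod_unfold)
qed

lemma C2_on_plane_z: "C2_on_plane D z"
proof -
  have "C1_on_plane D z"
    using continuous_on_partials_z z_has_partial_derivs[THEN has_field_derivative_imp_has_derivative, THEN Derivative.differentiableI]
    by (auto simp: C1_on_plane_def case_prod_unfold)
  moreover have "C1_on_plane D (dx z)"
    by (rule C1_on_plane_quotient[OF partials_z(1)])
       (auto intro: C2_on_has_derivs[OF open_I C2_\<phi>] C2_on_has_derivs[OF open_J C2_\<psi>]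
          C2_on_continuous_on[OF C2_\<phi>] C2_on_continuous_on[OF C2_\<psi>])
  moreover have "C1_on_plane D (dy z)"
    by (rule C1_on_plane_quotient[OF partials_z(2)])
       (auto intro: C2_on_has_derivs[OF open_I C2_\<phi>] C2_on_has_derivs[OF open_J C2_\<psi>]
          C2_on_continuous_on[OF C2_\<phi>] C2_on_continuous_on[OF C2_\<psi>])
  ultimately show ?thesis
    by (simp add: C2_on_plane_def)
qed

text \<open>The twice differentiated implicit equation, kept free of division so that its left sides
  can be substituted as whole terms in \<open>surface_equation_numerator\<close>.\<close>

lemma second_partials_z:
  assumes "(x, y) \<in> D"
  shows "deriv \<zeta> (z x y) * dx (dx z) x y + deriv (deriv \<zeta>) (z x y) * (dx z x y)\<^sup>2
      = deriv (deriv \<phi>) x * \<psi> y"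
    and "deriv \<zeta> (z x y) * dy (dx z) x y + deriv (deriv \<zeta>) (z x y) * dx z x y * dy z x y
      = deriv \<phi> x * deriv \<psi> y"
    and "deriv \<zeta> (z x y) * dy (dy z) x y + deriv (deriv \<zeta>) (z x y) * (dy z x y)\<^sup>2
      = \<phi> x * deriv (deriv \<psi>) y"
proof -
  note f = C2_on_has_derivs[OF open_I C2_\<phi> in_D(1)[OF assms]]
  note g = C2_on_has_derivs[OF open_J C2_\<psi> in_D(2)[OF assms]]
  note n0 = in_D(5)[OF assms]
  have "dx (dx z) x y = (deriv (deriv \<phi>) x * \<psi> y
      - deriv (deriv \<zeta>) (z x y) * dx z x y * dx z x y) / deriv \<zeta> (z x y)"
    unfolding dx_def[of "dx z"]
    by (intro DERIV_imp_deriv quotient_has_partial_derivs(1)[OF assms partials_z(1) f(2) g(1)])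
  then show "deriv \<zeta> (z x y) * dx (dx z) x y + deriv (deriv \<zeta>) (z x y) * (dx z x y)\<^sup>2
      = deriv (deriv \<phi>) x * \<psi> y"
    using n0 by (simp add: power2_eq_square)
  have "dy (dx z) x y = (deriv \<phi> x * deriv \<psi> y
      - deriv (deriv \<zeta>) (z x y) * dy z x y * dx z x y) / deriv \<zeta> (z x y)"
    unfolding dy_def[of "dx z"]
    by (intro DERIV_imp_deriv quotient_has_partial_derivs(2)[OF assms partials_z(1) f(2) g(1)])
  then show "deriv \<zeta> (z x y) * dy (dx z) x y + deriv (deriv \<zeta>) (z x y) * dx z x y * dy z x y
      = deriv \<phi> x * deriv \<psi> y"
    using n0 by simp
  have "dy (dy z) x y = (\<phi> x * deriv (deriv \<psi>) y
      - deriv (deriv \<zeta>) (z x y) * dy z x y * dy z x y) / deriv \<zeta> (z x y)"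
    unfolding dy_def[of "dy z"]
    by (intro DERIV_imp_deriv quotient_has_partial_derivs(2)[OF assms partials_z(2) f(1) g(2)])
  then show "deriv \<zeta> (z x y) * dy (dy z) x y + deriv (deriv \<zeta>) (z x y) * (dy z x y)\<^sup>2
      = \<phi> x * deriv (deriv \<psi>) y"
    using n0 by (simp add: power2_eq_square)
qed

end

section \<open>Algebraic form of the surface equation and of the generating relations\<close>

text \<open>Here \<open>u\<close>, \<open>v\<close> stand for the values of \<phi>, \<psi>, then
  \<open>d\<close>, \<open>e\<close>, \<open>Z\<close> for the first and \<open>d2\<close>,
  \<open>e2\<close>, \<open>Z2\<close> for the second derivatives of \<phi>, \<psi>,
  \<zeta>.\<close>

lemma surface_equation_numerator:
  fixes u v d e Z Z2 d2 e2 zx zy zxx zxy zyy :: real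
  assumes d: "d\<^sup>2 = a1 - 2 * b1 * u\<^sup>2 + c1 * u ^ 4" "d2 = 2 * c1 * u ^ 3 - 2 * b1 * u"
    and e: "e\<^sup>2 = a2 - 2 * b2 * v\<^sup>2 + c2 * v ^ 4" "e2 = 2 * c2 * v ^ 3 - 2 * b2 * v"
    and Z: "Z\<^sup>2 = c3 + 2 * b3 * (u * v)\<^sup>2 + a3 * (u * v) ^ 4"
      "Z2 = 2 * a3 * (u * v) ^ 3 + 2 * b3 * (u * v)"
    and z1: "Z * zx = d * v" "Z * zy = u * e"
    and z2: "Z * zxx + Z2 * zx\<^sup>2 = d2 * v" "Z * zxy + Z2 * zx * zy = d * e"
      "Z * zyy + Z2 * zy\<^sup>2 = u * e2"
  shows "((1 - zy\<^sup>2) * zxx + 2 * zx * zy * zxy + (1 - zx\<^sup>2) * zyy) * Z ^ 3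
    = 2 * u * v * ((a1 * a2 - c3 * (b1 + b2)) + (c1 * c3 - a2 * (b1 + b3)) * u\<^sup>2
        + (c2 * c3 - a1 * (b2 + b3)) * v\<^sup>2 + (c1 * (b2 + b3) - a2 * a3) * (u\<^sup>2)\<^sup>2 * v\<^sup>2
        + (c2 * (b1 + b3) - a1 * a3) * u\<^sup>2 * (v\<^sup>2)\<^sup>2 + (a3 * (b1 + b2) - c1 * c2) * (u\<^sup>2)\<^sup>2 * (v\<^sup>2)\<^sup>2)"
proof -
  \<comment> \<open>Completing the second derivatives of z to the left sides of \<open>z2\<close>
    introduces terms with \<open>Z2\<close>. Those of degree four in \<open>zx\<close>,
    \<open>zy\<close> cancel, and the rest is the last summand.\<close>
  have "((1 - zy\<^sup>2) * zxx + 2 * zx * zy * zxy + (1 - zx\<^sup>2) * zyy) * Z ^ 3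
      = (Z\<^sup>2 - (Z * zy)\<^sup>2) * (Z * zxx + Z2 * zx\<^sup>2) + 2 * (Z * zx) * (Z * zy) * (Z * zxy + Z2 * zx * zy)
        + (Z\<^sup>2 - (Z * zx)\<^sup>2) * (Z * zyy + Z2 * zy\<^sup>2) - Z2 * ((Z * zx)\<^sup>2 + (Z * zy)\<^sup>2)"
    by algebra
  \<comment> \<open>Now \<open>d\<close>, \<open>e\<close>, \<open>Z\<close> occur only squared, so
    their differential equations eliminate them without any choice of sign.\<close>
  also have "\<dots> = (Z\<^sup>2 - u\<^sup>2 * e\<^sup>2) * (d2 * v) + 2 * u * v * d\<^sup>2 * e\<^sup>2
        + (Z\<^sup>2 - d\<^sup>2 * v\<^sup>2) * (u * e2) - Z2 * (d\<^sup>2 * v\<^sup>2 + u\<^sup>2 * e\<^sup>2)"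
    unfolding z1 z2 by algebra
  also have "\<dots> = 2 * u * v * ((a1 * a2 - c3 * (b1 + b2)) + (c1 * c3 - a2 * (b1 + b3)) * u\<^sup>2
        + (c2 * c3 - a1 * (b2 + b3)) * v\<^sup>2 + (c1 * (b2 + b3) - a2 * a3) * (u\<^sup>2)\<^sup>2 * v\<^sup>2
        + (c2 * (b1 + b3) - a1 * a3) * u\<^sup>2 * (v\<^sup>2)\<^sup>2 + (a3 * (b1 + b2) - c1 * c2) * (u\<^sup>2)\<^sup>2 * (v\<^sup>2)\<^sup>2)"
    unfolding d e Z by algebra
  finally show ?thesis .
qed

lemma quadratic_zero_on_infinite:
  fixes k0 k1 k2 :: real
  assumes "infinite S" "\<And>t. t \<in> S \<Longrightarrow> k0 + k1 * t + k2 * t\<^sup>2 = 0"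
  shows "k0 = 0" "k1 = 0" "k2 = 0"
proof -
  have "poly [:k0, k1, k2:] t = 0" if "t \<in> S" for t
    using assms(2)[OF that] by (simp add: power2_eq_square algebra_simps)
  then have "infinite {t. poly [:k0, k1, k2:] t = 0}"
    using assms(1) by (metis (mono_tags, lifting) infinite_super mem_Collect_eq subsetI)
  then have "[:k0, k1, k2:] = 0"
    using poly_roots_finite by blast
  then show "k0 = 0" "k1 = 0" "k2 = 0"
    by auto
qed

text \<open>Three indices exhausting a three-element type are distinct, which leaves the six
  permutations.\<close>

lemma all_triples_eq_UNIV_3:
  "(\<forall>i j k. {i, j, k} = (UNIV :: 3 set) \<longrightarrow> Q i j k) \<longleftrightarrow>
    Q 1 2 3 \<and> Q 1 3 2 \<and> Q 2 1 3 \<and> Q 2 3 1 \<and> Q 3 1 2 \<and> Q 3 2 1"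
proof -
  have "{i, j, k} = (UNIV :: 3 set) \<longleftrightarrow>
      (i, j, k) \<in> {(1, 2, 3), (1, 3, 2), (2, 1, 3), (2, 3, 1), (3, 1, 2), (3, 2, 1)}" for i j k
    using exhaust_3[of i] exhaust_3[of j] exhaust_3[of k]
    by (elim disjE) (simp_all add: set_eq_iff forall_3)
  then show ?thesis
    by simp blast
qed

text \<open>Interchanging \<alpha> with \<beta>, or j with k, only commutes a product. Hence the 36
  instances collapse to nine, one for each pair of i and \<gamma>.\<close>

lemma generating_rows:
  "generating (vector [vector [a1, \<beta>1, c1], vector [a2, \<beta>2, c2], vector [a3, \<beta>3, c3]]) \<longleftrightarrow>
    \<not> (a1 = 0 \<and> \<beta>1 = 0 \<and> c1 = 0 \<and> a2 = 0 \<and> \<beta>2 = 0 \<and> c2 = 0 \<and> a3 = 0 \<and> \<beta>3 = 0 \<and> c3 = 0) \<and>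
    a1 * \<beta>1 = c2 * c3 \<and> a1 * c1 = \<beta>2 * \<beta>3 \<and> \<beta>1 * c1 = a2 * a3 \<and>
    a2 * \<beta>2 = c1 * c3 \<and> a2 * c2 = \<beta>1 * \<beta>3 \<and> \<beta>2 * c2 = a1 * a3 \<and>
    a3 * \<beta>3 = c1 * c2 \<and> a3 * c3 = \<beta>1 * \<beta>2 \<and> \<beta>3 * c3 = a1 * a2"
  (is "generating ?A \<longleftrightarrow> \<not> ?Z \<and> ?R")
proof -
  have "?A = 0 \<longleftrightarrow> ?Z"
    by (auto simp: vec_eq_iff forall_3 vector_3)
  moreover have "(\<forall>i j k. {i, j, k} = UNIV \<longrightarrow> (\<forall>\<alpha> \<beta> \<gamma>. {\<alpha>, \<beta>, \<gamma>} = UNIV \<longrightarrow>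
      ?A $ i $ \<alpha> * ?A $ i $ \<beta> = ?A $ j $ \<gamma> * ?A $ k $ \<gamma>)) \<longleftrightarrow> ?R"
    unfolding all_triples_eq_UNIV_3 vector_3 by (auto simp: mult.commute)
  ultimately show ?thesis
    by (simp only: generating_def imp_conjL all_simps)
qed

section \<open>Comparison of coefficients\<close>

locale elliptic_surface = implicit_surface +
  fixes a1 a2 a3 b1 b2 b3 c1 c2 c3 :: real
  assumes connected_I: "connected I" and connected_J: "connected J" and connected_K: "connected K"
    and ode_\<phi>: "\<And>x. x \<in> I \<Longrightarrow> (deriv \<phi> x)\<^sup>2 = a1 - 2 * b1 * (\<phi> x)\<^sup>2 + c1 * (\<phi> x) ^ 4"
    and ode_\<psi>: "\<And>y. y \<in> J \<Longrightarrow> (deriv \<psi> y)\<^sup>2 = a2 - 2 * b2 * (\<psi> y)\<^sup>2 + c2 * (\<psi> y) ^ 4"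
    and ode_\<zeta>: "\<And>t. t \<in> K \<Longrightarrow> (deriv \<zeta> t)\<^sup>2 = c3 + 2 * b3 * (\<zeta> t)\<^sup>2 + a3 * (\<zeta> t) ^ 4"
    and nc_\<phi>: "\<not> \<phi> constant_on I" and nc_\<psi>: "\<not> \<psi> constant_on J"
    and nonempty_D: "D \<noteq> {}"
begin

text \<open>\<open>U\<close> and \<open>V\<close> stand for the squares of \<phi> and \<psi>. Of the
  nine monomials of degree at most 2 in each variable, U^2, V^2 and UV do not occur, so six
  relations can be read off.\<close>

definition coefficient_poly :: "real \<Rightarrow> real \<Rightarrow> real" where
  "coefficient_poly U V = (a1 * a2 - c3 * (b1 + b2)) + (c1 * c3 - a2 * (b1 + b3)) * U
    + (c2 * c3 - a1 * (b2 + b3)) * V + (c1 * (b2 + b3) - a2 * a3) * U\<^sup>2 * V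
    + (c2 * (b1 + b3) - a1 * a3) * U * V\<^sup>2 + (a3 * (b1 + b2) - c1 * c2) * U\<^sup>2 * V\<^sup>2"

lemma poly_ode:
  shows "x \<in> I \<Longrightarrow> (deriv \<phi> x)\<^sup>2 = poly [:a1, 0, - 2 * b1, 0, c1:] (\<phi> x)"
    and "y \<in> J \<Longrightarrow> (deriv \<psi> y)\<^sup>2 = poly [:a2, 0, - 2 * b2, 0, c2:] (\<psi> y)"
    and "t \<in> K \<Longrightarrow> (deriv \<zeta> t)\<^sup>2 = poly [:c3, 0, 2 * b3, 0, a3:] (\<zeta> t)"
proof -
  have "poly [:a, 0, b, 0, c:] u = a + b * u\<^sup>2 + c * u ^ 4" for a b c u :: real
    by (simp add: power2_eq_square power4_eq_xxxx algebra_simps)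
  then show "x \<in> I \<Longrightarrow> (deriv \<phi> x)\<^sup>2 = poly [:a1, 0, - 2 * b1, 0, c1:] (\<phi> x)"
    and "y \<in> J \<Longrightarrow> (deriv \<psi> y)\<^sup>2 = poly [:a2, 0, - 2 * b2, 0, c2:] (\<psi> y)"
    and "t \<in> K \<Longrightarrow> (deriv \<zeta> t)\<^sup>2 = poly [:c3, 0, 2 * b3, 0, a3:] (\<zeta> t)"
    by (simp_all only: ode_\<phi> ode_\<psi> ode_\<zeta>)
qed

text \<open>On \<open>D\<close> the derivative of \<zeta> is non-zero, so division suffices there.
  The derivatives of \<phi> and \<psi> may vanish, which calls for
  \<open>ode_second_deriv\<close>.\<close>

lemma second_derivs:
  shows "x \<in> I \<Longrightarrow> deriv (deriv \<phi>) x = 2 * c1 * (\<phi> x) ^ 3 - 2 * b1 * \<phi> x"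
    and "y \<in> J \<Longrightarrow> deriv (deriv \<psi>) y = 2 * c2 * (\<psi> y) ^ 3 - 2 * b2 * \<psi> y"
    and "t \<in> K \<Longrightarrow> deriv \<zeta> t \<noteq> 0 \<Longrightarrow> deriv (deriv \<zeta>) t = 2 * a3 * (\<zeta> t) ^ 3 + 2 * b3 * \<zeta> t"
  using ode_second_deriv[OF open_I connected_I C2_\<phi> poly_ode(1) nc_\<phi>, of x]
    ode_second_deriv[OF open_J connected_J C2_\<psi> poly_ode(2) nc_\<psi>, of y]
    ode_second_deriv_of_deriv_nonzero[OF open_K C2_\<zeta> poly_ode(3), of t]
  by (simp_all add: pderiv_pCons power3_eq_cube algebra_simps)

lemma surface_operator_eq_0_iff:
  assumes xy: "(x, y) \<in> D"
  shows "(1 - (dy z x y)\<^sup>2) * dx (dx z) x y + 2 * dx z x y * dy z x y * dy (dx z) x y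
      + (1 - (dx z x y)\<^sup>2) * dy (dy z) x y = 0
    \<longleftrightarrow> \<phi> x * \<psi> y * coefficient_poly ((\<phi> x)\<^sup>2) ((\<psi> y)\<^sup>2) = 0"
proof -
  note D = in_D[OF xy]
  have z1: "deriv \<zeta> (z x y) * dx z x y = deriv \<phi> x * \<psi> y"
    "deriv \<zeta> (z x y) * dy z x y = \<phi> x * deriv \<psi> y"
    using D(5) by (simp_all add: partials_z[OF xy])
  have "((1 - (dy z x y)\<^sup>2) * dx (dx z) x y + 2 * dx z x y * dy z x y * dy (dx z) x y
      + (1 - (dx z x y)\<^sup>2) * dy (dy z) x y) * deriv \<zeta> (z x y) ^ 3
    = 2 * \<phi> x * \<psi> y * coefficient_poly ((\<phi> x)\<^sup>2) ((\<psi> y)\<^sup>2)"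
    unfolding coefficient_poly_def
    by (rule surface_equation_numerator[OF ode_\<phi>[OF D(1)] second_derivs(1)[OF D(1)]
          ode_\<psi>[OF D(2)] second_derivs(2)[OF D(2)]
          ode_\<zeta>[OF D(3), unfolded D(4)] second_derivs(3)[OF D(3,5), unfolded D(4)]
          z1 second_partials_z[OF xy]])
  moreover have "E = 0 \<longleftrightarrow> u * v * g = 0" if "E * Z ^ 3 = 2 * u * v * g" "Z \<noteq> 0" for E Z u v g :: real
    using that by (cases "E = 0") auto
  ultimately show ?thesis
    using D(5) by blast
qed

lemma maximal_surface_iff_coefficient_poly:
  "maximal_surface_solution D z \<longleftrightarrow>
    (\<forall>(x, y)\<in>D. \<phi> x * \<psi> y * coefficient_poly ((\<phi> x)\<^sup>2) ((\<psi> y)\<^sup>2) = 0)"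
  using surface_operator_eq_0_iff
  by (simp add: maximal_surface_solution_def C2_on_plane_z case_prod_unfold)

lemma maximal_surface_iff_coefficients:
  "maximal_surface_solution D z \<longleftrightarrow>
    a1 * a2 = c3 * (b1 + b2) \<and> c1 * c3 = a2 * (b1 + b3) \<and> c2 * c3 = a1 * (b2 + b3) \<and>
    c1 * (b2 + b3) = a2 * a3 \<and> c2 * (b1 + b3) = a1 * a3 \<and> a3 * (b1 + b2) = c1 * c2"
  (is "_ \<longleftrightarrow> ?R")
proof
  assume ?R
  then show "maximal_surface_solution D z"
    by (simp add: maximal_surface_iff_coefficient_poly coefficient_poly_def)
next
  assume "maximal_surface_solution D z"
  then have zero: "\<phi> x * \<psi> y * coefficient_poly ((\<phi> x)\<^sup>2) ((\<psi> y)\<^sup>2) = 0" if "(x, y) \<in> D" for x y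
    using that by (auto simp: maximal_surface_iff_coefficient_poly)
  obtain x0 y0 where "(x0, y0) \<in> D"
    using nonempty_D by auto
  \<comment> \<open>A box inside \<open>D\<close> lets x and y, and hence the values of \<phi> and
    \<psi>, vary independently.\<close>
  then obtain S T where ST: "open S" "open T" "x0 \<in> S" "y0 \<in> T" "S \<times> T \<subseteq> D"
    using open_prod_elim[OF open_D] by (metis mem_Sigma_iff)
  obtain r s where rs: "r > 0" "ball x0 r \<subseteq> S" "s > 0" "ball y0 s \<subseteq> T"
    using ST by (meson open_contains_ball)
  then have box: "ball x0 r \<times> ball y0 s \<subseteq> D"
    using ST(5) by blast
  then have sub: "ball x0 r \<subseteq> I" "ball y0 s \<subseteq> J"
    using D_subset rs(1,3) centre_in_ball[of x0 r] centre_in_ball[of y0 s] by blast+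
  let ?U = "(\<lambda>x. (\<phi> x)\<^sup>2) ` ball x0 r - {0}" and ?V = "(\<lambda>y. (\<psi> y)\<^sup>2) ` ball y0 s - {0}"
  have inf: "infinite ?U" "infinite ?V"
    using ode_infinite_squares[OF open_I connected_I C2_\<phi> poly_ode(1) nc_\<phi> open_ball connected_ball sub(1)]
      ode_infinite_squares[OF open_J connected_J C2_\<psi> poly_ode(2) nc_\<psi> open_ball connected_ball sub(2)]
      rs(1,3) by auto
  have G0: "coefficient_poly U V = 0" if "U \<in> ?U" "V \<in> ?V" for U V
    using that zero box by fastforce
  \<comment> \<open>For fixed \<open>V\<close> the polynomial is a quadratic in \<open>U\<close>
    with infinitely many zeros. Its three coefficients are polynomials in \<open>V\<close>, padded
    with \<open>0\<close> to fit \<open>quadratic_zero_on_infinite\<close>, which is then applied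
    again.\<close>
  have coeffs: "(a1 * a2 - c3 * (b1 + b2)) + (c2 * c3 - a1 * (b2 + b3)) * V = 0"
      "(c1 * c3 - a2 * (b1 + b3)) + 0 * V + (c2 * (b1 + b3) - a1 * a3) * V\<^sup>2 = 0"
      "0 + (c1 * (b2 + b3) - a2 * a3) * V + (a3 * (b1 + b2) - c1 * c2) * V\<^sup>2 = 0"
    if V: "V \<in> ?V" for V
  proof -
    have "((a1 * a2 - c3 * (b1 + b2)) + (c2 * c3 - a1 * (b2 + b3)) * V)
      + ((c1 * c3 - a2 * (b1 + b3)) + 0 * V + (c2 * (b1 + b3) - a1 * a3) * V\<^sup>2) * U
      + (0 + (c1 * (b2 + b3) - a2 * a3) * V + (a3 * (b1 + b2) - c1 * c2) * V\<^sup>2) * U\<^sup>2 = 0"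
      if "U \<in> ?U" for U
      using G0[OF that V] by (simp add: coefficient_poly_def algebra_simps)
    from quadratic_zero_on_infinite[OF inf(1) this]
    show "(a1 * a2 - c3 * (b1 + b2)) + (c2 * c3 - a1 * (b2 + b3)) * V = 0"
      "(c1 * c3 - a2 * (b1 + b3)) + 0 * V + (c2 * (b1 + b3) - a1 * a3) * V\<^sup>2 = 0"
      "0 + (c1 * (b2 + b3) - a2 * a3) * V + (a3 * (b1 + b2) - c1 * c2) * V\<^sup>2 = 0"
      by blast+
  qed
  have "(a1 * a2 - c3 * (b1 + b2)) + (c2 * c3 - a1 * (b2 + b3)) * V + 0 * V\<^sup>2 = 0" if "V \<in> ?V" for V
    using coeffs(1)[OF that] by simp
  from quadratic_zero_on_infinite[OF inf(2) this] quadratic_zero_on_infinite[OF inf(2) coeffs(2)]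
    quadratic_zero_on_infinite[OF inf(2) coeffs(3)]
  show ?R
    by simp
qed

section \<open>Degenerate coefficients, trivial solutions and the equivalence\<close>

lemma nc_\<zeta>: "\<not> \<zeta> constant_on K"
proof
  assume "\<zeta> constant_on K"
  then obtain c where c: "\<And>t. t \<in> K \<Longrightarrow> \<zeta> t = c"
    by (auto simp: constant_on_def)
  obtain x y where xy: "(x, y) \<in> D"
    using nonempty_D by auto
  have "deriv \<zeta> (z x y) = 0"
    by (intro DERIV_imp_deriv
        has_field_derivative_transform_within_open[OF DERIV_const open_K in_D(3)[OF xy]]) (simp add: c)
  then show False
    using in_D(5)[OF xy] by simp
qed

text \<open>All three functions are exponentials up to sign, so the logarithm of the implicit
  equation is linear in x, y and z.\<close>

lemma trivial_if_exponential:
  assumes "a1 = 0" "c1 = 0" "a2 = 0" "c2 = 0" "a3 = 0" "c3 = 0"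
  shows "trivial_solution D z"
proof -
  have odes: "\<And>x. x \<in> I \<Longrightarrow> (deriv \<phi> x)\<^sup>2 = - 2 * b1 * (\<phi> x)\<^sup>2"
      "\<And>y. y \<in> J \<Longrightarrow> (deriv \<psi> y)\<^sup>2 = - 2 * b2 * (\<psi> y)\<^sup>2"
      "\<And>t. t \<in> K \<Longrightarrow> (deriv \<zeta> t)\<^sup>2 = 2 * b3 * (\<zeta> t)\<^sup>2"
    using assms ode_\<phi> ode_\<psi> ode_\<zeta> by auto
  obtain m1 n1 where 1: "\<And>x. x \<in> I \<Longrightarrow> \<phi> x \<noteq> 0 \<and> ln \<bar>\<phi> x\<bar> = m1 * x + n1"
    using exponential_of_ode[OF open_I connected_I C2_\<phi> odes(1) nc_\<phi>] by blast
  obtain m2 n2 where 2: "\<And>y. y \<in> J \<Longrightarrow> \<psi> y \<noteq> 0 \<and> ln \<bar>\<psi> y\<bar> = m2 * y + n2"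
    using exponential_of_ode[OF open_J connected_J C2_\<psi> odes(2) nc_\<psi>] by blast
  obtain m3 n3 where 3: "m3 \<noteq> 0" "\<And>t. t \<in> K \<Longrightarrow> \<zeta> t \<noteq> 0 \<and> ln \<bar>\<zeta> t\<bar> = m3 * t + n3"
    using exponential_of_ode[OF open_K connected_K C2_\<zeta> odes(3) nc_\<zeta>] by blast
  have "z x y = (m1 / m3) * x + (m2 / m3) * y + (n1 + n2 - n3) / m3" if "(x, y) \<in> D" for x y
  proof -
    note D = in_D[OF that]
    have "m3 * z x y + n3 = ln \<bar>\<phi> x * \<psi> y\<bar>"
      using 3(2)[OF D(3)] D(4) by simp
    also have "\<dots> = ln \<bar>\<phi> x\<bar> + ln \<bar>\<psi> y\<bar>"
      using 1[OF D(1)] 2[OF D(2)] by (simp add: abs_mult ln_mult)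
    also have "\<dots> = (m1 * x + n1) + (m2 * y + n2)"
      using 1[OF D(1)] 2[OF D(2)] by simp
    finally have "z x y = (m1 * x + m2 * y + (n1 + n2 - n3)) / m3"
      using 3(1) by (simp add: eq_divide_eq algebra_simps)
    then show ?thesis
      by (simp add: add_divide_distrib)
  qed
  then show ?thesis
    unfolding trivial_solution_def by blast
qed

text \<open>Both \<psi> and \<zeta> satisfy f'^2 = k f^2 with the same k, since
  \<open>- b2 = b3\<close>. Hence (\<phi> \<psi>')^2 = k (\<phi> \<psi>)^2 = \<zeta>'^2, and the
  quotient is the square of z_y.\<close>

lemma trivial_if_dy_unit:
  assumes "a2 = 0" "c2 = 0" "a3 = 0" "c3 = 0" "b2 + b3 = 0"
  shows "trivial_solution D z"
proof -
  have "(dy z x y)\<^sup>2 = 1" if "(x, y) \<in> D" for x y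
  proof -
    note D = in_D[OF that]
    have "(\<phi> x * deriv \<psi> y)\<^sup>2 = (deriv \<zeta> (z x y))\<^sup>2"
      using ode_\<psi>[OF D(2)] ode_\<zeta>[OF D(3)] D(4) assms
      by (simp add: power_mult_distrib add_eq_0_iff)
    then show ?thesis
      using D(5) by (simp add: partials_z[OF that] power_divide)
  qed
  then show ?thesis
    unfolding trivial_solution_def by blast
qed

lemma trivial_if_dx_unit:
  assumes "a1 = 0" "c1 = 0" "a3 = 0" "c3 = 0" "b1 + b3 = 0"
  shows "trivial_solution D z"
proof -
  have "(dx z x y)\<^sup>2 = 1" if "(x, y) \<in> D" for x y
  proof -
    note D = in_D[OF that]
    have "(deriv \<phi> x * \<psi> y)\<^sup>2 = (deriv \<zeta> (z x y))\<^sup>2"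
      using ode_\<phi>[OF D(1)] ode_\<zeta>[OF D(3)] D(4) assms
      by (simp add: power_mult_distrib add_eq_0_iff)
    then show ?thesis
      using D(5) by (simp add: partials_z[OF that] power_divide)
  qed
  then show ?thesis
    unfolding trivial_solution_def by blast
qed

text \<open>A non-constant real solution of f'^2 = -2 b f^2 forces b < 0, so both summands are
  negative. This excludes the zero matrix and settles the degenerate case of the third row.\<close>

lemma sum_b12_nonzero_if_exponential:
  assumes "a1 = 0" "c1 = 0" "a2 = 0" "c2 = 0"
  shows "b1 + b2 \<noteq> 0"
proof -
  obtain x where x: "x \<in> I" "deriv \<phi> x \<noteq> 0"
    using zero_deriv_imp_constant_on[OF open_I connected_I C2_\<phi>] nc_\<phi> by blast
  have "0 < - 2 * b1 * (\<phi> x)\<^sup>2"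
    using ode_\<phi>[OF x(1)] x(2) assms zero_less_power2[of "deriv \<phi> x"] by simp
  then have b1: "b1 < 0"
    by (simp add: mult_less_0_iff)
  obtain y where y: "y \<in> J" "deriv \<psi> y \<noteq> 0"
    using zero_deriv_imp_constant_on[OF open_J connected_J C2_\<psi>] nc_\<psi> by blast
  have "0 < - 2 * b2 * (\<psi> y)\<^sup>2"
    using ode_\<psi>[OF y(1)] y(2) assms zero_less_power2[of "deriv \<psi> y"] by simp
  then have "b2 < 0"
    by (simp add: mult_less_0_iff)
  with b1 show ?thesis
    by simp
qed

text \<open>Of the nine generating relations the surface equation yields only six, those with
  \<open>\<gamma> \<noteq> 2\<close>; missing are \<open>a\<^sub>i c\<^sub>i = \<beta>\<^sub>j \<beta>\<^sub>k\<close>. The six make \<open>a\<^sub>i c\<^sub>i - \<beta>\<^sub>j \<beta>\<^sub>k\<close> vanish when multiplied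
  by \<open>a\<close> or \<open>c\<close> of either of the other two rows; if these four are all zero, the solution is trivial.\<close>

lemma generating_of_maximal_surface:
  assumes sol: "maximal_surface_solution D z" and nt: "\<not> trivial_solution D z"
  shows "generating (vector [vector [a1, b2 + b3, c1], vector [a2, b1 + b3, c2], vector [a3, b1 + b2, c3]])"
proof -
  define \<beta>1 \<beta>2 \<beta>3 where \<beta>: "\<beta>1 = b2 + b3" "\<beta>2 = b1 + b3" "\<beta>3 = b1 + b2"
  have six: "a1 * a2 = c3 * \<beta>3" "c1 * c3 = a2 * \<beta>2" "c2 * c3 = a1 * \<beta>1"
      "c1 * \<beta>1 = a2 * a3" "c2 * \<beta>2 = a1 * a3" "a3 * \<beta>3 = c1 * c2"
    using sol by (auto simp: maximal_surface_iff_coefficients \<beta>)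
  have 1: "a1 * c1 = \<beta>2 * \<beta>3"
  proof (rule ccontr)
    assume ne: "a1 * c1 \<noteq> \<beta>2 * \<beta>3"
    have "c3 * (a1 * c1 - \<beta>2 * \<beta>3) = 0" "a2 * (a1 * c1 - \<beta>2 * \<beta>3) = 0"
      "c2 * (a1 * c1 - \<beta>2 * \<beta>3) = 0" "a3 * (a1 * c1 - \<beta>2 * \<beta>3) = 0"
      using six by algebra+
    then have z: "c3 = 0" "a2 = 0" "c2 = 0" "a3 = 0"
      using ne by auto
    \<comment> \<open>The surviving relations are \<open>a1 * \<beta>1 = 0\<close> and
      \<open>c1 * \<beta>1 = 0\<close>: either z_y^2 = 1, or all three functions are
      exponentials.\<close>
    have "\<beta>1 = 0 \<or> a1 = 0 \<and> c1 = 0"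
      using six(3,4) z by auto
    then show False
      using trivial_if_dy_unit trivial_if_exponential nt z \<beta>(1) by auto
  qed
  have 2: "a2 * c2 = \<beta>1 * \<beta>3"
  proof (rule ccontr)
    assume ne: "a2 * c2 \<noteq> \<beta>1 * \<beta>3"
    have "c3 * (a2 * c2 - \<beta>1 * \<beta>3) = 0" "a1 * (a2 * c2 - \<beta>1 * \<beta>3) = 0"
      "c1 * (a2 * c2 - \<beta>1 * \<beta>3) = 0" "a3 * (a2 * c2 - \<beta>1 * \<beta>3) = 0"
      using six by algebra+
    then have z: "c3 = 0" "a1 = 0" "c1 = 0" "a3 = 0"
      using ne by auto
    have "\<beta>2 = 0 \<or> a2 = 0 \<and> c2 = 0"
      using six(2,5) z by auto
    then show False
      using trivial_if_dx_unit trivial_if_exponential nt z \<beta>(2) by auto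
  qed
  have 3: "a3 * c3 = \<beta>1 * \<beta>2"
  proof (rule ccontr)
    assume ne: "a3 * c3 \<noteq> \<beta>1 * \<beta>2"
    have "a1 * (a3 * c3 - \<beta>1 * \<beta>2) = 0" "a2 * (a3 * c3 - \<beta>1 * \<beta>2) = 0"
      "c1 * (a3 * c3 - \<beta>1 * \<beta>2) = 0" "c2 * (a3 * c3 - \<beta>1 * \<beta>2) = 0"
      using six by algebra+
    then have z: "a1 = 0" "a2 = 0" "c1 = 0" "c2 = 0"
      using ne by auto
    \<comment> \<open>Two relations reduce to \<open>a3 * \<beta>3 = 0\<close> and
      \<open>c3 * \<beta>3 = 0\<close>. Since \<beta>3 cannot vanish here, only the exponential case
      remains.\<close>
    then have "a3 = 0" "c3 = 0"
      using six(1,6) sum_b12_nonzero_if_exponential \<beta>(3) by auto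
    then show False
      using trivial_if_exponential nt z by auto
  qed
  have "\<not> (a1 = 0 \<and> c1 = 0 \<and> a2 = 0 \<and> c2 = 0 \<and> \<beta>3 = 0)"
    using sum_b12_nonzero_if_exponential \<beta>(3) by auto
  then show ?thesis
    unfolding generating_rows \<beta>[symmetric] using six 1 2 3 by (auto simp: mult.commute)
qed

text \<open>The six coefficient relations are among the nine generating ones, so this direction
  covers trivial solutions as well.\<close>

lemma maximal_surface_of_generating:
  assumes "generating (vector [vector [a1, b2 + b3, c1], vector [a2, b1 + b3, c2], vector [a3, b1 + b2, c3]])"
  shows "maximal_surface_solution D z"
  using assms unfolding generating_rows maximal_surface_iff_coefficients
  by (simp add: mult.commute)

end

theorem theorem4:
  fixes \<phi> \<psi> \<zeta> :: "real \<Rightarrow> real" and z :: "real \<Rightarrow> real \<Rightarrow> real"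
    and I J K :: "real set" and D :: "(real \<times> real) set"
    and a1 a2 a3 b1 b2 b3 c1 c2 c3 \<beta>1 \<beta>2 \<beta>3 :: real and A :: "real^3^3"
  assumes "open I" "connected I" "open J" "connected J" "open K" "connected K"
    and "C2_on I \<phi>" "C2_on J \<psi>" "C2_on K \<zeta>"
    and "\<And>x. x \<in> I \<Longrightarrow> (deriv \<phi> x)\<^sup>2 = a1 - 2 * b1 * (\<phi> x)\<^sup>2 + c1 * (\<phi> x) ^ 4"
    and "\<And>y. y \<in> J \<Longrightarrow> (deriv \<psi> y)\<^sup>2 = a2 - 2 * b2 * (\<psi> y)\<^sup>2 + c2 * (\<psi> y) ^ 4"
    and "\<And>t. t \<in> K \<Longrightarrow> (deriv \<zeta> t)\<^sup>2 = c3 + 2 * b3 * (\<zeta> t)\<^sup>2 + a3 * (\<zeta> t) ^ 4"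
    and "\<not> \<phi> constant_on I" "\<not> \<psi> constant_on J"
    and "open D" "D \<noteq> {}" "D \<subseteq> I \<times> J" "\<And>x y. (x, y) \<in> D \<Longrightarrow> z x y \<in> K"
    and "implicitly_defined D \<phi> \<psi> \<zeta> z"
    and "\<beta>1 = b2 + b3" "\<beta>2 = b1 + b3" "\<beta>3 = b1 + b2"
    and "A = vector [vector [a1, \<beta>1, c1],
                     vector [a2, \<beta>2, c2],
                     vector [a3, \<beta>3, c3]]"
  shows "(generating A \<longrightarrow> maximal_surface_solution D z) \<and>
         (\<not> trivial_solution D z \<longrightarrow> (maximal_surface_solution D z \<longleftrightarrow> generating A))"
proof -
  interpret elliptic_surface \<phi> \<psi> \<zeta> z I J K D a1 a2 a3 b1 b2 b3 c1 c2 c3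
    by unfold_locales (use assms in auto)
  show ?thesis
    using maximal_surface_of_generating generating_of_maximal_surface assms(20-23) by blast
qed

end
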